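(* There exists an infinite family of finite bipartite graphs $(G_k)_k$ for which $$\mathrm{fool}(G_k)\;\ge\;\bigl(\operatorname{rk} M(G_k)\bigr)^{\log_4 6}.$$
   Context: For a finite bipartite graph $G$ with bipartition $U\uplus V$, $M(G)$ denotes its bipartite adjacency matrix: the 01-matrix with rows indexed by $U$, columns indexed by $V$, and entry $1$ at position $(u,v)$ if $uv\in E(G)$ and $0$ otherwise. $\operatorname{rk}$ denotes the rank of this matrix over the real numbers. A fooling set in $G$ is a set $F\subseteq E(G)$ such that no two distinct edges in $F$ induce a complete bipartite graph; that is, any two distinct edges of $F$ are not incident and are not contained together in a cycle of length four of $G$. $\mathrm{fool}(G)$ is the maximum cardinality of a fooling set in $G$. *)

theory Defs
  imports Complex_Main "Jordan_Normal_Form.DL_Rank"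
begin

record 'a bip_graph =
  left_verts :: "'a set"
  right_verts :: "'a set"
  edges :: "'a set set"

definition finite_bipartite_graph :: "'a bip_graph \<Rightarrow> bool" where
  "finite_bipartite_graph G \<longleftrightarrow>
     finite (left_verts G) \<and> finite (right_verts G) \<and>
     left_verts G \<inter> right_verts G = {} \<and>
     edges G \<subseteq> {{u, v} | u v. u \<in> left_verts G \<and> v \<in> right_verts G}"

text \<open>
  Rows and columns are listed in increasing vertex order. The order affects the matrix
  only by row and column permutations, hence not its rank.
\<close>

definition bip_adj_mat :: "'a::linorder bip_graph \<Rightarrow> real mat" where
  "bip_adj_mat G =
     mat (card (left_verts G)) (card (right_verts G))
       (\<lambda>(i, j). if {sorted_list_of_set (left_verts G) ! i,
                     sorted_list_of_set (right_verts G) ! j} \<in> edges G then 1 else 0)"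

abbreviation mat_rank :: "real mat \<Rightarrow> nat" where
  "mat_rank A \<equiv> vec_space.rank (dim_row A) A"

definition induced_bip_graph :: "'a bip_graph \<Rightarrow> 'a set \<Rightarrow> 'a bip_graph" where
  "induced_bip_graph G W =
     \<lparr>left_verts = left_verts G \<inter> W, right_verts = right_verts G \<inter> W,
      edges = {e \<in> edges G. e \<subseteq> W}\<rparr>"

definition complete_bipartite :: "'a bip_graph \<Rightarrow> bool" where
  "complete_bipartite G \<longleftrightarrow> (\<forall>u\<in>left_verts G. \<forall>v\<in>right_verts G. {u, v} \<in> edges G)"

definition fooling_set :: "'a bip_graph \<Rightarrow> 'a set set \<Rightarrow> bool" where
  "fooling_set G F \<longleftrightarrow>
     F \<subseteq> edges G \<and>
     (\<forall>e\<in>F. \<forall>f\<in>F. e \<noteq> f \<longrightarrow> \<not> complete_bipartite (induced_bip_graph G (e \<union> f)))"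

definition fool :: "'a bip_graph \<Rightarrow> nat" where
  "fool G = Max {card F | F. fooling_set G F}"

definition four_cycle :: "'a bip_graph \<Rightarrow> 'a set set \<Rightarrow> bool" where
  "four_cycle G C \<longleftrightarrow>
     (\<exists>a b c d. distinct [a, b, c, d] \<and> C = {{a, b}, {b, c}, {c, d}, {d, a}} \<and> C \<subseteq> edges G)"

lemma fooling_set_iff_no_four_cycle:
  assumes "finite_bipartite_graph G"
  shows "fooling_set G F \<longleftrightarrow>
    F \<subseteq> edges G \<and>
    (\<forall>e\<in>F. \<forall>f\<in>F. e \<noteq> f \<longrightarrow> e \<inter> f = {} \<and> \<not> (\<exists>C. four_cycle G C \<and> e \<in> C \<and> f \<in> C))"
proof -
  let ?L = "left_verts G" and ?R = "right_verts G" and ?E = "edges G"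
  have disj: "x \<notin> ?R" if "x \<in> ?L" for x
    using assms that by (auto simp: finite_bipartite_graph_def)
  have ends: "\<exists>u v. e = {u, v} \<and> u \<in> ?L \<and> v \<in> ?R" if "e \<in> ?E" for e
    using assms that by (auto simp: finite_bipartite_graph_def)
  have one_left: "(p \<in> ?L) \<noteq> (q \<in> ?L)" if pq: "{p, q} \<in> ?E" for p q
  proof -
    obtain u v where "{p, q} = {u, v}" "u \<in> ?L" "v \<in> ?R" using ends[OF pq] by blast
    moreover have "v \<notin> ?L" using \<open>v \<in> ?R\<close> disj by blast
    ultimately show ?thesis unfolding doubleton_eq_iff by blast
  qed
  have "complete_bipartite (induced_bip_graph G (e \<union> f)) \<longleftrightarrow>
      e \<inter> f \<noteq> {} \<or> (\<exists>C. four_cycle G C \<and> e \<in> C \<and> f \<in> C)"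
    if e: "e \<in> ?E" and f: "f \<in> ?E" and ne: "e \<noteq> f" for e f
  proof -
    obtain u v where uv: "e = {u, v}" "u \<in> ?L" "v \<in> ?R" using ends[OF e] by blast
    obtain x y where xy: "f = {x, y}" "x \<in> ?L" "y \<in> ?R" using ends[OF f] by blast
    have L: "?L \<inter> (e \<union> f) = {u, x}" and R: "?R \<inter> (e \<union> f) = {v, y}"
      using uv xy disj by auto
    have cross: "u \<noteq> v" "u \<noteq> y" "x \<noteq> v" "x \<noteq> y" using uv xy disj by auto
    have comp: "complete_bipartite (induced_bip_graph G (e \<union> f)) \<longleftrightarrow>
        {u, y} \<in> ?E \<and> {x, v} \<in> ?E"
      unfolding complete_bipartite_def induced_bip_graph_def using L R e f uv xy
      by auto
    have inc: "e \<inter> f \<noteq> {} \<longleftrightarrow> u = x \<or> v = y" using uv xy cross by auto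
    show ?thesis
    proof (cases "u = x \<or> v = y")
      case True
      then have "{u, y} \<in> ?E \<and> {x, v} \<in> ?E" using e f uv xy by auto
      then show ?thesis using comp inc True by simp
    next
      case False
      have "\<exists>C. four_cycle G C \<and> e \<in> C \<and> f \<in> C" if "{u, y} \<in> ?E" "{x, v} \<in> ?E"
      proof (intro exI conjI)
        show "four_cycle G {{u, v}, {v, x}, {x, y}, {y, u}}"
          unfolding four_cycle_def
          by (rule exI[of _ u], rule exI[of _ v], rule exI[of _ x], rule exI[of _ y])
            (use that e f uv xy cross False in \<open>auto simp: insert_commute\<close>)
      qed (use uv xy in auto)
      moreover have "{u, y} \<in> ?E \<and> {x, v} \<in> ?E" if "four_cycle G C" "e \<in> C" "f \<in> C" for C
      proof -
        obtain a b c d where C: "distinct [a, b, c, d]" "C = {{a, b}, {b, c}, {c, d}, {d, a}}"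
          "C \<subseteq> ?E" using \<open>four_cycle G C\<close> unfolding four_cycle_def by (elim exE conjE)
        have opp: "{u, y} \<in> ?E \<and> {x, v} \<in> ?E"
          if pq: "{e, f} = {{p, q}, {r, s}}" and E: "{q, r} \<in> ?E" "{s, p} \<in> ?E"
          for p q r s
        proof -
          have "{p, q} \<in> {e, f}" "{r, s} \<in> {e, f}" using pq by auto
          then have "{p, q} \<in> ?E" "{r, s} \<in> ?E" using e f by auto
          then have alt: "(p \<in> ?L) \<noteq> (q \<in> ?L)" "(r \<in> ?L) \<noteq> (s \<in> ?L)"
              "(q \<in> ?L) \<noteq> (r \<in> ?L)" "(s \<in> ?L) \<noteq> (p \<in> ?L)"
            using E one_left by blast+
          have nL: "v \<notin> ?L" "y \<notin> ?L" using uv xy disj by auto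
          have "e = {p, q} \<and> f = {r, s} \<or> e = {r, s} \<and> f = {p, q}"
            using pq by (simp add: doubleton_eq_iff)
          then have "(u = p \<and> v = q \<or> u = q \<and> v = p) \<and> (x = r \<and> y = s \<or> x = s \<and> y = r) \<or>
              (u = r \<and> v = s \<or> u = s \<and> v = r) \<and> (x = p \<and> y = q \<or> x = q \<and> y = p)"
            unfolding uv(1) xy(1) by (simp add: doubleton_eq_iff)
          then show ?thesis
            using alt nL uv(2) xy(2) E
            by (elim disjE conjE; hypsubst) (simp_all add: insert_commute)
        qed
        have E: "{a, b} \<in> ?E" "{b, c} \<in> ?E" "{c, d} \<in> ?E" "{d, a} \<in> ?E" using C by auto
        have dj: "e \<inter> f = {}" using inc False by simp
        have mem: "e \<in> {{a, b}, {b, c}, {c, d}, {d, a}}" "f \<in> {{a, b}, {b, c}, {c, d}, {d, a}}"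
          using that(2,3) C(2) by simp_all
        have "{e, f} = {{a, b}, {c, d}} \<or> {e, f} = {{b, c}, {d, a}}"
          using mem dj by (elim insertE emptyE) (simp_all add: insert_commute)
        then show ?thesis
          using opp[of a b c d] opp[of b c d a] E by blast
      qed
      ultimately show ?thesis using comp inc False by blast
    qed
  qed
  then show ?thesis unfolding fooling_set_def by (meson subsetD)
qed

end

theory Submission
  imports Defs
begin

text \<open>
  The family consists of the Kronecker powers of one matrix \<open>M\<close>, the circulant of size six with
  first row \<open>1 1 1 0 0 0\<close>. Both sides of the claimed inequality are multiplicative under
  Kronecker products of this kind, so it suffices that \<open>M\<close> attains it: the rank of \<open>M\<close> is 4, and
  the six diagonal ones form a fooling set. The \<open>k\<close>-th power then has rank \<open>4^k\<close> and a fooling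
  set of size \<open>6^k = (4^k) powr log 4 6\<close>.

  The diagonal of a 01-matrix is a fooling set iff the entrywise product of the matrix with its
  transpose is the identity. For \<open>M\<close> this holds because the entry at \<open>(i, j)\<close> is one iff
  \<open>j - i\<close> lies in \<open>{0, 1, 2}\<close> modulo 6, and this set meets its negative only in 0
  (\<open>circ_fooling\<close>). Entrywise products, transposes and identities are all compatible with
  Kronecker powers, so the property is inherited by the powers.

  That the rank of \<open>M\<close> is 4 is explained by the symbol \<open>1 + x + x^2\<close>, which vanishes at exactly two of
  the sixth roots of unity. The proof uses certificates that survive Kronecker powers:
  a factorization of \<open>M\<close> through dimension 4 bounds the rank from above (\<open>circ_factorization\<close>),
  and an inverse of the upper left 4 by 4 corner bounds it from below (\<open>circ_corner_inverse\<close>).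
  Both are matrix identities, and the mixed product rule \<open>kron_mat_mult\<close> carries them over to
  the powers.
\<close>

section \<open>Rank and factorizations\<close>

lemma (in vec_space) rank_mult_le_left:
  assumes A: "A \<in> carrier_mat n m" and B: "B \<in> carrier_mat m l"
  shows "rank (A * B) \<le> rank A"
proof -
  have colsA: "set (cols A) \<subseteq> carrier_vec n" using A cols_dim by blast
  have AB: "A * B \<in> carrier_mat n l" using A B by simp
  have sub: "set (cols (A * B)) \<subseteq> span (set (cols A))"
  proof
    fix x assume "x \<in> set (cols (A * B))"
    then obtain j where j: "j < l" "x = col (A * B) j"
      using AB by (metis carrier_matD(2) cols_length cols_nth in_set_conv_nth)
    have "x = A *\<^sub>v col B j" unfolding j(2) by (rule col_mult2[OF A B j(1)])
    then show "x \<in> span (set (cols A))"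
      using col_space_eq[OF A] A B j by (auto simp: col_space_def)
  qed
  have subA: "subspace class_ring (span (set (cols A))) V" using colsA span_is_subspace by blast
  have "set (cols (A * B)) \<subseteq> carrier_vec n" using AB cols_dim by blast
  then have "subspace class_ring (span (set (cols (A * B)))) V" by (rule span_is_subspace)
  moreover have "span (set (cols (A * B))) \<subseteq> span (set (cols A))"
    using sub colsA by (metis span_is_submodule span_is_subset)
  ultimately have "subspace class_ring (span (set (cols (A * B)))) (span_vs (set (cols A)))"
    using nested_subspaces[OF subA] by blast
  from vectorspace.subspace_dim[OF subspace_is_vs[OF subA] this]
  show ?thesis unfolding rank_def
    using fin_dim_span_cols[OF A] fin_dim_span_cols[OF AB] by simp
qed

text \<open>
  Multiplying by the left inverse turns the columns of the matrix into distinct unit vectors and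
  kills every linear relation among them.
\<close>

lemma (in vec_space) rank_left_invertible:
  assumes A: "A \<in> carrier_mat n r" and P: "P \<in> carrier_mat r n" and PA: "P * A = 1\<^sub>m r"
  shows "rank A = r"
proof -
  have cancel: "v = P *\<^sub>v (A *\<^sub>v v)" if "v \<in> carrier_vec r" for v
    using that A P PA by (metis assoc_mult_mat_vec one_mult_mat_vec)
  have "distinct (cols A)"
  proof (unfold distinct_conv_nth, intro allI impI)
    fix i j assume ij: "i < length (cols A)" "j < length (cols A)" "i \<noteq> j"
    then have lt: "i < r" "j < r" using A by auto
    have "col (P * A) i = P *\<^sub>v col A i" "col (P * A) j = P *\<^sub>v col A j"
      using lt A P by (auto simp: col_mult2)
    moreover have "col (P * A) i \<noteq> col (P * A) j"
      using PA lt ij(3) by (simp add: unit_vec_eq)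
    ultimately show "cols A ! i \<noteq> cols A ! j" using ij by auto
  qed
  moreover have "lin_indpt (set (cols A))"
  proof
    assume "lin_dep (set (cols A))"
    with lin_depE[OF A _ \<open>distinct (cols A)\<close>]
    obtain v where v: "v \<in> carrier_vec r" "v \<noteq> 0\<^sub>v r" "A *\<^sub>v v = 0\<^sub>v n" by blast
    then have "v = 0\<^sub>v r" using cancel[OF v(1)] P by auto
    with v show False by simp
  qed
  ultimately show ?thesis using lin_indpt_full_rank[OF A] by blast
qed

text \<open>
  A certificate for the exact rank that consists of matrix identities only. The factorization
  gives the upper bound; for the lower bound, passing to \<open>(A * B) * Q\<close> does not increase the
  rank, and the result has \<open>P\<close> as a left inverse.
\<close>

lemma (in vec_space) rank_eqI_factorization:
  assumes A: "A \<in> carrier_mat n r" and B: "B \<in> carrier_mat r m"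
    and P: "P \<in> carrier_mat r n" and Q: "Q \<in> carrier_mat m r"
    and inv: "P * ((A * B) * Q) = 1\<^sub>m r"
  shows "rank (A * B) = r"
proof (rule antisym)
  show "rank (A * B) \<le> r"
    using rank_mult_le_left[OF A B] rank_le_nc[OF A] by linarith
  have AB: "A * B \<in> carrier_mat n m" using A B by simp
  then have "rank ((A * B) * Q) = r" using rank_left_invertible[OF _ P inv] Q by simp
  then show "r \<le> rank (A * B)" using rank_mult_le_left[OF AB Q] by simp
qed

section \<open>Kronecker powers\<close>

text \<open>
  The entries of the \<open>k\<close>-fold Kronecker power of a \<open>p\<close> by \<open>q\<close> matrix: rows are numbered by
  \<open>k\<close>-digit strings in base \<open>p\<close>, columns by \<open>k\<close>-digit strings in base \<open>q\<close>, and an entry is the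
  product of the entries of \<open>A\<close> at the \<open>k\<close> pairs of corresponding digits. Working with index
  functions reduces the algebra of Kronecker powers to arithmetic of digits.
\<close>

primrec kron_power ::
  "nat \<Rightarrow> nat \<Rightarrow> (nat \<Rightarrow> nat \<Rightarrow> 'a::comm_semiring_1) \<Rightarrow> nat \<Rightarrow> nat \<Rightarrow> nat \<Rightarrow> 'a" where
  "kron_power p q A 0 i j = 1"
| "kron_power p q A (Suc k) i j =
     A (i mod p) (j mod q) * kron_power p q A k (i div p) (j div q)"

text \<open>
  Splitting off the last digit of \<open>t\<close> in base \<open>q\<close> is a bijection onto pairs; this is the step
  that turns sums over digit strings into products of sums over single digits.
\<close>

lemma sum_mod_div:
  fixes f g :: "nat \<Rightarrow> 'a::comm_semiring_1"
  shows "(\<Sum>t<q * n. f (t mod q) * g (t div q)) = (\<Sum>t<q. f t) * (\<Sum>t<n. g t)"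
proof (induction n)
  case (Suc n)
  have "(\<Sum>t<q * Suc n. f (t mod q) * g (t div q)) =
      (\<Sum>t<q * n. f (t mod q) * g (t div q)) + (\<Sum>s<q. f ((s + q * n) mod q) * g ((s + q * n) div q))"
    using sum.atLeastLessThan_concat[of 0 "q * n" "q * Suc n" "\<lambda>t. f (t mod q) * g (t div q)"]
      sum.shift_bounds_nat_ivl[of "\<lambda>t. f (t mod q) * g (t div q)" 0 "q * n" q]
    by (simp add: lessThan_atLeast0 add.commute)
  also have "(\<Sum>s<q. f ((s + q * n) mod q) * g ((s + q * n) div q)) = (\<Sum>s<q. f s) * g n"
    unfolding sum_distrib_right by (intro sum.cong) auto
  finally show ?case using Suc by (simp add: algebra_simps)
qed simp

text \<open>The mixed product rule: Kronecker powers commute with matrix multiplication.\<close>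

lemma kron_power_mult:
  "(\<Sum>t<q ^ k. kron_power p q A k i t * kron_power q r B k t j) =
     kron_power p r (\<lambda>i j. \<Sum>t<q. A i t * B t j) k i j"
proof (induction k arbitrary: i j)
  case (Suc k)
  show ?case
    using sum_mod_div[where f = "\<lambda>t. A (i mod p) t * B t (j mod r)"
        and g = "\<lambda>t. kron_power p q A k (i div p) t * kron_power q r B k t (j div r)"
        and q = q and n = "q ^ k"]
    by (simp add: Suc ac_simps)
qed simp

lemma kron_power_cong:
  assumes "0 < p" "0 < q" "\<And>i j. i < p \<Longrightarrow> j < q \<Longrightarrow> A i j = B i j"
  shows "kron_power p q A k i j = kron_power p q B k i j"
  using assms by (induction k arbitrary: i j) auto

text \<open>
  The fooling property of a matrix says that its entrywise product with its transpose is the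
  identity, so this lemma is what makes the property pass to Kronecker powers.
\<close>

lemma kron_power_hadamard_transpose:
  "kron_power p p A k i j * kron_power p p A k j i = kron_power p p (\<lambda>i j. A i j * A j i) k i j"
proof (induction k arbitrary: i j)
  case (Suc k)
  show ?case by (simp add: Suc[symmetric] ac_simps)
qed simp

text \<open>Two numbers below \<open>p ^ k\<close> are equal iff all their digits agree.\<close>

lemma kron_power_identity:
  assumes "0 < p" "i < p ^ k" "j < p ^ k"
  shows "kron_power p p (\<lambda>i j. if i = j then 1 else 0) k i j = (if i = j then 1 else 0)"
  using assms
proof (induction k arbitrary: i j)
  case (Suc k)
  have lt: "i div p < p ^ k" "j div p < p ^ k"
    using Suc.prems by (simp_all add: less_mult_imp_div_less mult.commute)
  have "i = j \<longleftrightarrow> i mod p = j mod p \<and> i div p = j div p"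
    by (metis mult_div_mod_eq)
  then show ?case using Suc.IH[OF Suc.prems(1) lt] by auto
qed simp

lemma kron_power_01:
  assumes "\<And>i j. A i j \<in> {0, 1}"
  shows "kron_power p q A k i j \<in> {0, 1}"
proof (induction k arbitrary: i j)
  case (Suc k)
  show ?case using assms[of "i mod p" "j mod q"] Suc[of "i div p" "j div q"] by auto
qed simp

definition kron_mat :: "nat \<Rightarrow> nat \<Rightarrow> (nat \<Rightarrow> nat \<Rightarrow> 'a::comm_semiring_1) \<Rightarrow> nat \<Rightarrow> 'a mat" where
  "kron_mat p q A k = mat (p ^ k) (q ^ k) (\<lambda>(i, j). kron_power p q A k i j)"

lemma kron_mat_carrier [simp]: "kron_mat p q A k \<in> carrier_mat (p ^ k) (q ^ k)"
  by (simp add: kron_mat_def)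

lemma kron_mat_mult:
  assumes "0 < p" "0 < r" "\<And>i j. i < p \<Longrightarrow> j < r \<Longrightarrow> (\<Sum>t<q. A i t * B t j) = C i j"
  shows "kron_mat p q A k * kron_mat q r B k = kron_mat p r C k"
proof (rule eq_matI)
  fix i j assume "i < dim_row (kron_mat p r C k)" "j < dim_col (kron_mat p r C k)"
  then have ij: "i < p ^ k" "j < r ^ k" by (simp_all add: kron_mat_def)
  have "(kron_mat p q A k * kron_mat q r B k) $$ (i, j) =
      (\<Sum>t<q ^ k. kron_power p q A k i t * kron_power q r B k t j)"
    using ij by (simp add: kron_mat_def scalar_prod_def lessThan_atLeast0)
  also have "\<dots> = kron_power p r C k i j"
    unfolding kron_power_mult by (rule kron_power_cong) (use assms in auto)
  finally show "(kron_mat p q A k * kron_mat q r B k) $$ (i, j) = kron_mat p r C k $$ (i, j)"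
    using ij by (simp add: kron_mat_def)
qed (simp_all add: kron_mat_def)

lemma kron_mat_identity:
  assumes "0 < p"
  shows "kron_mat p p (\<lambda>i j. if i = j then 1 else 0) k = 1\<^sub>m (p ^ k)"
  by (rule eq_matI) (use assms in \<open>simp_all add: kron_mat_def kron_power_identity\<close>)

section \<open>The graph of a square 01-matrix\<close>

text \<open>
  Row \<open>u\<close> is the vertex \<open>u\<close> and column \<open>v\<close> is the vertex \<open>n + v\<close>, so that the increasing
  order on vertices lists rows and columns in their original order.
\<close>

definition matrix_graph :: "nat \<Rightarrow> (nat \<Rightarrow> nat \<Rightarrow> real) \<Rightarrow> nat bip_graph" where
  "matrix_graph n T = \<lparr>left_verts = {0..<n}, right_verts = {n..<n + n},
     edges = {{u, n + v} | u v. u < n \<and> v < n \<and> T u v = 1}\<rparr>"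

lemma matrix_graph_edge_iff:
  assumes "u < n" "v < n"
  shows "{u, n + v} \<in> edges (matrix_graph n T) \<longleftrightarrow> T u v = 1"
  using assms by (auto simp: matrix_graph_def doubleton_eq_iff)

lemma finite_bipartite_matrix_graph: "finite_bipartite_graph (matrix_graph n T)"
  unfolding finite_bipartite_graph_def matrix_graph_def by force

lemma bip_adj_mat_matrix_graph:
  assumes "\<And>i j. i < n \<Longrightarrow> j < n \<Longrightarrow> T i j \<in> {0, 1}"
  shows "bip_adj_mat (matrix_graph n T) = mat n n (\<lambda>(i, j). T i j)"
proof (rule eq_matI)
  fix i j assume "i < dim_row (mat n n (\<lambda>(i, j). T i j))" "j < dim_col (mat n n (\<lambda>(i, j). T i j))"
  then have ij: "i < n" "j < n" by simp_all
  have "left_verts (matrix_graph n T) = {0..<n}" "right_verts (matrix_graph n T) = {n..<n + n}"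
    by (simp_all add: matrix_graph_def)
  then show "bip_adj_mat (matrix_graph n T) $$ (i, j) = mat n n (\<lambda>(i, j). T i j) $$ (i, j)"
    using ij assms[OF ij] matrix_graph_edge_iff[OF ij, of T] by (auto simp: bip_adj_mat_def)
qed (simp_all add: bip_adj_mat_def matrix_graph_def)

text \<open>
  Finiteness of the graph matters here: the maximum that defines \<open>fool\<close> is meaningful only over a
  finite set of cardinalities.
\<close>

lemma card_le_fool:
  assumes "finite_bipartite_graph G" "fooling_set G F"
  shows "card F \<le> fool G"
proof -
  have "finite {{u, v} | u v. u \<in> left_verts G \<and> v \<in> right_verts G}"
    using assms(1) by (intro finite_image_set2) (simp_all add: finite_bipartite_graph_def)
  then have "finite (edges G)"
    using assms(1) unfolding finite_bipartite_graph_def by (meson finite_subset)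
  then have "finite {F. fooling_set G F}"
    by (rule finite_subset[rotated, OF finite_Pow_iff[THEN iffD2]]) (auto simp: fooling_set_def)
  then have "finite {card F | F. fooling_set G F}" by simp
  then show ?thesis unfolding fool_def using assms(2) by (auto intro: Max_ge)
qed

text \<open>
  The diagonal edges \<open>i\<close> and \<open>j\<close> induce a complete bipartite graph only if the entries at
  \<open>(i, j)\<close> and \<open>(j, i)\<close> are both one, which the vanishing of their product rules out.
\<close>

lemma fool_matrix_graph_ge:
  assumes fooling: "\<And>i j. i < n \<Longrightarrow> j < n \<Longrightarrow> T i j * T j i = (if i = j then 1 else 0)"
    and diag: "\<And>i. i < n \<Longrightarrow> T i i = 1"
  shows "n \<le> fool (matrix_graph n T)"
proof -
  let ?G = "matrix_graph n T"
  let ?F = "(\<lambda>i. {i, n + i}) ` {0..<n}"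
  have "fooling_set ?G ?F"
    unfolding fooling_set_def
  proof (intro conjI ballI impI notI)
    show "?F \<subseteq> edges ?G" using diag by (auto simp: matrix_graph_edge_iff)
    fix e f
    assume "e \<in> ?F" "f \<in> ?F" "e \<noteq> f"
      and complete: "complete_bipartite (induced_bip_graph ?G (e \<union> f))"
    obtain i where "e = {i, n + i}" "i < n" using \<open>e \<in> ?F\<close> by auto
    moreover obtain j where "f = {j, n + j}" "j < n" using \<open>f \<in> ?F\<close> by auto
    moreover note \<open>e \<noteq> f\<close>
    ultimately have ij: "e = {i, n + i}" "f = {j, n + j}" "i < n" "j < n" "i \<noteq> j" by auto
    have "{i, n + j} \<in> edges ?G" "{j, n + i} \<in> edges ?G"
      using complete ij
      unfolding complete_bipartite_def induced_bip_graph_def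
      by (auto simp: matrix_graph_def)
    then have "T i j = 1" "T j i = 1" using ij by (simp_all add: matrix_graph_edge_iff)
    then show False using fooling[of i j] ij by simp
  qed
  moreover have "card ?F = n"
    by (subst card_image) (auto intro!: inj_onI simp: doubleton_eq_iff)
  ultimately show ?thesis
    using card_le_fool[OF finite_bipartite_matrix_graph] by metis
qed

section \<open>A fooling matrix of size six and rank four\<close>

text \<open>
  The entry is one iff \<open>j - i\<close> is 0, 1 or 2 modulo 6; writing \<open>5 * i\<close> for \<open>- i\<close> avoids
  truncated subtraction.
\<close>

definition circ :: "nat \<Rightarrow> nat \<Rightarrow> real" where
  "circ i j = (if (j + 5 * i) mod 6 < 3 then 1 else 0)"

text \<open>
  Coordinates of the rows of the circulant with respect to its first four rows. Rows \<open>r\<close> and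
  \<open>r + 3\<close> have complementary supports, so they always add up to the all-ones vector; hence row 4
  is row 0 plus row 3 minus row 1, and row 5 is row 0 plus row 3 minus row 2.
\<close>

definition circ_coords :: "nat \<Rightarrow> nat \<Rightarrow> real" where
  "circ_coords i t =
     [[1, 0, 0, 0], [0, 1, 0, 0], [0, 0, 1, 0], [0, 0, 0, 1], [1, -1, 0, 1], [1, 0, -1, 1]] ! i ! t"

text \<open>
  The upper left 4 by 4 corner is \<open>1 + S + S^2\<close> for the nilpotent shift \<open>S\<close> with \<open>S^4 = 0\<close>, so
  its inverse is \<open>(1 - S) (1 + S^3) = 1 - S + S^3\<close>. The two zero rows discard the last two columns
  of the circulant.
\<close>

definition circ_corner_inverse :: "nat \<Rightarrow> nat \<Rightarrow> real" where
  "circ_corner_inverse t j =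
     [[1, -1, 0, 1], [0, 1, -1, 0], [0, 0, 1, -1], [0, 0, 0, 1], [0, 0, 0, 0], [0, 0, 0, 0]] ! t ! j"

lemma less_6_cases: "i < (6::nat) \<Longrightarrow> i = 0 \<or> i = 1 \<or> i = 2 \<or> i = 3 \<or> i = 4 \<or> i = 5"
  by auto

lemma less_4_cases: "i < (4::nat) \<Longrightarrow> i = 0 \<or> i = 1 \<or> i = 2 \<or> i = 3"
  by auto

lemma sum_lessThan_4:
  fixes f :: "nat \<Rightarrow> 'a::comm_monoid_add"
  shows "(\<Sum>t<4. f t) = f 0 + f 1 + f 2 + f 3"
  by (simp add: eval_nat_numeral add.assoc)

lemma sum_lessThan_6:
  fixes f :: "nat \<Rightarrow> 'a::comm_monoid_add"
  shows "(\<Sum>t<6. f t) = f 0 + f 1 + f 2 + f 3 + f 4 + f 5"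
  by (simp add: eval_nat_numeral add.assoc)

lemma circ_fooling:
  assumes "i < 6" "j < 6"
  shows "circ i j * circ j i = (if i = j then 1 else 0)"
  using less_6_cases[OF assms(1)] less_6_cases[OF assms(2)]
  by (elim disjE; simp add: circ_def)

lemma circ_factorization:
  assumes "i < 6" "j < 6"
  shows "(\<Sum>t<4. circ_coords i t * circ t j) = circ i j"
  using less_6_cases[OF assms(1)] less_6_cases[OF assms(2)]
  by (elim disjE; simp add: circ_def circ_coords_def sum_lessThan_4)

lemma circ_corner_inverse:
  assumes "i < 4" "j < 4"
  shows "(\<Sum>t<6. circ i t * circ_corner_inverse t j) = (if i = j then 1 else 0)"
  using less_4_cases[OF assms(1)] less_4_cases[OF assms(2)]
  by (elim disjE; simp add: circ_def circ_corner_inverse_def sum_lessThan_6)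

text \<open>
  The certificate consists of the Kronecker powers of the factorization through the first four
  rows (\<open>?A\<close> and \<open>?B\<close>), of the selection of the first four rows (\<open>?P\<close>), and of the corner
  inverse (\<open>?Q\<close>).
\<close>

lemma rank_kron_mat_circ:
  "vec_space.rank (6 ^ k) (kron_mat 6 6 circ k) = 4 ^ k"
proof -
  let ?I = "\<lambda>i j :: nat. if i = j then 1 else 0 :: real"
  let ?A = "kron_mat 6 4 circ_coords k" and ?B = "kron_mat 4 6 circ k"
  let ?P = "kron_mat 4 6 ?I k" and ?Q = "kron_mat 6 4 circ_corner_inverse k"
  let ?R = "\<lambda>i j. \<Sum>t<6. circ i t * circ_corner_inverse t j"
  have AB: "?A * ?B = kron_mat 6 6 circ k"
    by (rule kron_mat_mult) (simp_all add: circ_factorization)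
  have "?P * ((?A * ?B) * ?Q) = ?P * kron_mat 6 4 ?R k"
    unfolding AB by (subst kron_mat_mult[where C = ?R]) simp_all
  also have "\<dots> = kron_mat 4 4 ?I k"
  proof (rule kron_mat_mult)
    fix i j :: nat assume "i < 4" "j < 4"
    have "(\<Sum>t<6. ?I i t * ?R t j) = (\<Sum>t<6. if t = i then ?R i j else 0)"
      by (rule sum.cong) auto
    also have "\<dots> = ?R i j" using \<open>i < 4\<close> by (simp add: sum.delta)
    also have "\<dots> = ?I i j" using \<open>i < 4\<close> \<open>j < 4\<close> by (rule circ_corner_inverse)
    finally show "(\<Sum>t<6. ?I i t * ?R t j) = ?I i j" .
  qed simp_all
  also have "\<dots> = 1\<^sub>m (4 ^ k)" by (rule kron_mat_identity) simp
  finally show ?thesis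
    using vec_space.rank_eqI_factorization[of ?A "6 ^ k" "4 ^ k" ?B "6 ^ k" ?P ?Q] AB by simp
qed

theorem proposition3:
  shows "\<exists>G :: nat \<Rightarrow> nat bip_graph.
    (\<forall>k. finite_bipartite_graph (G k)) \<and>
    strict_mono (\<lambda>k. mat_rank (bip_adj_mat (G k))) \<and>
    (\<forall>k. real (fool (G k)) \<ge> real (mat_rank (bip_adj_mat (G k))) powr log 4 6)"
proof -
  let ?T = "\<lambda>k. kron_power 6 6 circ k"
  let ?G = "\<lambda>k. matrix_graph (6 ^ k) (?T k)"
  have T01: "?T k i j \<in> {0, 1}" for k i j
    by (rule kron_power_01) (simp add: circ_def)
  have fooling: "?T k i j * ?T k j i = (if i = j then 1 else 0)"
    if "i < 6 ^ k" "j < 6 ^ k" for k i j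
  proof -
    have "?T k i j * ?T k j i = kron_power 6 6 (\<lambda>i j. if i = j then 1 else 0) k i j"
      unfolding kron_power_hadamard_transpose by (rule kron_power_cong) (simp_all add: circ_fooling)
    then show ?thesis using that by (simp add: kron_power_identity)
  qed
  have diag: "?T k i i = 1" if "i < 6 ^ k" for k i
    using fooling[OF that that] T01[of k i i] by auto
  have rank: "mat_rank (bip_adj_mat (?G k)) = 4 ^ k" for k
  proof -
    have "bip_adj_mat (?G k) = kron_mat 6 6 circ k"
      unfolding kron_mat_def by (rule bip_adj_mat_matrix_graph) (rule T01)
    then show ?thesis
      using rank_kron_mat_circ[of k] carrier_matD(1)[OF kron_mat_carrier[of 6 6 circ k]] by simp
  qed
  have "real (mat_rank (bip_adj_mat (?G k))) powr log 4 6 \<le> real (fool (?G k))" for k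
  proof -
    have "real (mat_rank (bip_adj_mat (?G k))) powr log 4 6 = (4 powr real k) powr log 4 6"
      by (simp add: rank powr_realpow)
    also have "\<dots> = (4 powr log 4 6) powr real k" by (simp only: powr_powr mult.commute)
    also have "\<dots> = real (6 ^ k)" by (simp add: powr_realpow)
    also have "\<dots> \<le> real (fool (?G k))"
      using fool_matrix_graph_ge[of "6 ^ k" "?T k"] fooling diag of_nat_le_iff by blast
    finally show ?thesis .
  qed
  moreover have "strict_mono (\<lambda>k. mat_rank (bip_adj_mat (?G k)))"
    unfolding rank by (rule strict_monoI) (simp add: power_strict_increasing)
  ultimately show ?thesis
    using finite_bipartite_matrix_graph by (intro exI[of _ ?G]) blast
qed

end
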